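(* Consider an instance of Multistage Knapsack with $T$ time steps and its linear relaxation (LP-MK). Let $\hat S=(\hat x,\hat z)$ be a feasible solution of (LP-MK) with $\hat z_{ti}=1-|\hat x_{(t+1)i}-\hat x_{ti}|$ for all $t\in\{1,\dots,T-1\}$ and $i\in N$. If $\hat S$ is a basic solution of (LP-MK), then at most $T^3$ objects are fractional in $\hat S$, where an object $i$ is fractional if at least one of the variables $\hat x_{ti}$ ($1\le t\le T$) or $\hat z_{ti}$ ($1\le t\le T-1$) is not an integer.
   Context: Multistage Knapsack: given a time horizon $T\ge 1$, objects $N=\{1,\dots,n\}$, for each $t\in\{1,\dots,T\}$ and $i\in N$ a profit $p_{ti}$ and a weight $w_{ti}$, for each $t\in\{1,\dots,T-1\}$ and $i\in N$ a bonus $B_{ti}\ge 0$, and capacities $C_t$. (LP-MK) is the linear program with variables $x_{ti}\in[0,1]$ ($t=1,\dots,T$, $i\in N$) and $z_{ti}\in[0,1]$ ($t=1,\dots,T-1$, $i\in N$): maximize $\sum_{t=1}^T\sum_{i\in N}p_{ti}x_{ti}+\sum_{t=1}^{T-1}\sum_{i\in N}B_{ti}z_{ti}$ subject to $\sum_{i\in N}w_{ti}x_{ti}\le C_t$ for all $t$, $z_{ti}\le -x_{(t+1)i}+x_{ti}+1$ and $z_{ti}\le x_{(t+1)i}-x_{ti}+1$ for all $t\le T-1$, $i\in N$. A basic solution is a vertex (extreme point) of its feasible polyhedron, i.e. a feasible point that is not the midpoint of two distinct feasible points. *)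

theory Defs
  imports Complex_Main
begin

record multistage_knapsack =
  horizon  :: nat
  objects  :: nat
  profit   :: "nat \<Rightarrow> nat \<Rightarrow> real"
  weight   :: "nat \<Rightarrow> nat \<Rightarrow> real"
  bonus    :: "nat \<Rightarrow> nat \<Rightarrow> real"
  capacity :: "nat \<Rightarrow> real"

text \<open>All double indices are written time first, object second. The times are
  \<open>{1..horizon K}\<close>, the transitions \<open>{1..<horizon K}\<close> (transition \<open>t\<close> leads from time \<open>t\<close> to
  time \<open>t + 1\<close>) and the objects \<open>{1..objects K}\<close>; data outside these ranges are ignored.\<close>

definition valid_instance :: "multistage_knapsack \<Rightarrow> bool" where
  "valid_instance K \<longleftrightarrow>
     1 \<le> horizon K \<and> (\<forall>t\<in>{1..<horizon K}. \<forall>i\<in>{1..objects K}. 0 \<le> bonus K t i)"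

text \<open>A point of the variable space of (LP-MK) is a pair \<open>(x, z)\<close> of which only the entries within
  the index ranges matter.\<close>

type_synonym lp_point = "(nat \<Rightarrow> nat \<Rightarrow> real) \<times> (nat \<Rightarrow> nat \<Rightarrow> real)"

fun lp_objective :: "multistage_knapsack \<Rightarrow> lp_point \<Rightarrow> real" where
  "lp_objective K (x, z) =
     (\<Sum>t\<in>{1..horizon K}. \<Sum>i\<in>{1..objects K}. profit K t i * x t i) +
     (\<Sum>t\<in>{1..<horizon K}. \<Sum>i\<in>{1..objects K}. bonus K t i * z t i)"

fun lp_feasible :: "multistage_knapsack \<Rightarrow> lp_point \<Rightarrow> bool" where
  "lp_feasible K (x, z) \<longleftrightarrow>
     (\<forall>t\<in>{1..horizon K}. \<forall>i\<in>{1..objects K}. 0 \<le> x t i \<and> x t i \<le> 1) \<and>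
     (\<forall>t\<in>{1..<horizon K}. \<forall>i\<in>{1..objects K}. 0 \<le> z t i \<and> z t i \<le> 1) \<and>
     (\<forall>t\<in>{1..horizon K}. (\<Sum>i\<in>{1..objects K}. weight K t i * x t i) \<le> capacity K t) \<and>
     (\<forall>t\<in>{1..<horizon K}. \<forall>i\<in>{1..objects K}.
        z t i \<le> - x (t + 1) i + x t i + 1 \<and> z t i \<le> x (t + 1) i - x t i + 1)"

text \<open>Equality of points of the variable space, i.e. on the index ranges only.\<close>

fun lp_same :: "multistage_knapsack \<Rightarrow> lp_point \<Rightarrow> lp_point \<Rightarrow> bool" where
  "lp_same K (x, z) (x', z') \<longleftrightarrow>
     (\<forall>t\<in>{1..horizon K}. \<forall>i\<in>{1..objects K}. x t i = x' t i) \<and>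
     (\<forall>t\<in>{1..<horizon K}. \<forall>i\<in>{1..objects K}. z t i = z' t i)"

fun lp_midpoint :: "lp_point \<Rightarrow> lp_point \<Rightarrow> lp_point" where
  "lp_midpoint (x, z) (x', z') =
     (\<lambda>t i. (x t i + x' t i) / 2, \<lambda>t i. (z t i + z' t i) / 2)"

definition lp_basic :: "multistage_knapsack \<Rightarrow> lp_point \<Rightarrow> bool" where
  "lp_basic K S \<longleftrightarrow> lp_feasible K S \<and>
     \<not> (\<exists>S1 S2. lp_feasible K S1 \<and> lp_feasible K S2 \<and> \<not> lp_same K S1 S2 \<and>
          lp_same K S (lp_midpoint S1 S2))"

fun fractional_object :: "multistage_knapsack \<Rightarrow> lp_point \<Rightarrow> nat \<Rightarrow> bool" where
  "fractional_object K (x, z) i \<longleftrightarrow>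
     (\<exists>t\<in>{1..horizon K}. x t i \<notin> \<int>) \<or> (\<exists>t\<in>{1..<horizon K}. z t i \<notin> \<int>)"

end

theory Submission
  imports Defs
begin

text \<open>Pick for each fractional object \<open>i\<close> a time \<open>u i\<close> with \<open>x (u i) i\<close> fractional and move
  simultaneously all \<open>x t i\<close> that share this value. Small moves of this kind keep every sign of
  \<open>x (t + 1) i - x t i\<close>, so \<open>z\<close> can follow linearly, and only the \<open>T\<close> capacity constraints
  couple different objects. With more than \<open>T\<close> fractional objects the \<open>T\<close> linear conditions on
  the speeds have a nontrivial solution, and moving back and forth along it contradicts
  extremality. Hence there are even at most \<open>T\<close> fractional objects.\<close>

text \<open>Gaussian elimination, one equation per induction step: equation \<open>s\<close> is
  either void on \<open>F\<close> or solved for a pivot variable \<open>j\<close>, which removes one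
  equation and one unknown. The induction generalizes over \<open>a\<close> because elimination
  changes the coefficients.\<close>

lemma underdetermined_system_nontrivial_solution:
  fixes a :: "'a \<Rightarrow> 'b \<Rightarrow> 'c::field"
  assumes "finite A" "finite F" "card A < card F"
  shows "\<exists>c. (\<exists>i\<in>F. c i \<noteq> 0) \<and> (\<forall>t\<in>A. (\<Sum>i\<in>F. a t i * c i) = 0)"
  using assms
proof (induction A arbitrary: F a rule: finite_induct)
  case empty
  then obtain j where "j \<in> F" by fastforce
  then show ?case by (intro exI[of _ "\<lambda>_. 1"]) auto
next
  case (insert s A)
  show ?case
  proof (cases "\<forall>i\<in>F. a s i = 0")
    case True
    moreover obtain c where "\<exists>i\<in>F. c i \<noteq> 0" "\<forall>t\<in>A. (\<Sum>i\<in>F. a t i * c i) = 0"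
      using insert.IH[of F a] insert.prems insert.hyps by auto
    ultimately show ?thesis by (intro exI[of _ c]) auto
  next
    case False
    then obtain j where j: "j \<in> F" "a s j \<noteq> 0" by blast
    define G where "G = F - {j}"
    have G: "finite G" "F = insert j G" "j \<notin> G" using insert.prems j by (auto simp: G_def)
    then have "card A < card G" using insert.prems insert.hyps by simp
    \<comment> \<open>The new coefficients are those of row \<open>t\<close> minus
      \<open>a t j / a s j\<close> times row \<open>s\<close>, which cancels column
      \<open>j\<close>.\<close>
    then obtain c where c: "\<exists>i\<in>G. c i \<noteq> 0"
        "\<forall>t\<in>A. (\<Sum>i\<in>G. (a t i - a t j * a s i / a s j) * c i) = 0"
      using insert.IH[of G "\<lambda>t i. a t i - a t j * a s i / a s j"] G(1) by blast
    define S where "S = (\<Sum>i\<in>G. a s i * c i)"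
    \<comment> \<open>Back substitution: the value at \<open>j\<close> is the one that equation
      \<open>s\<close> forces.\<close>
    define c' where "c' = c(j := - S / a s j)"
    have sum_c': "(\<Sum>i\<in>F. a t i * c' i) = (\<Sum>i\<in>G. a t i * c i) - a t j * S / a s j" for t
    proof -
      have "(\<Sum>i\<in>G. a t i * c' i) = (\<Sum>i\<in>G. a t i * c i)"
        using G(3) by (intro sum.cong) (auto simp: c'_def)
      then show ?thesis using G by (simp add: c'_def)
    qed
    have "(\<Sum>i\<in>G. a t i * c i) - a t j * S / a s j = 0" if "t \<in> A" for t
    proof -
      have "(\<Sum>i\<in>G. (a t i - a t j * a s i / a s j) * c i)
          = (\<Sum>i\<in>G. a t i * c i - a t j / a s j * (a s i * c i))"
        by (intro sum.cong) (auto simp: algebra_simps)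
      also have "\<dots> = (\<Sum>i\<in>G. a t i * c i) - a t j / a s j * S"
        by (simp add: S_def sum_subtractf sum_distrib_left)
      finally show ?thesis using c(2) that by simp
    qed
    moreover have "(\<Sum>i\<in>G. a s i * c i) - a s j * S / a s j = 0"
      using j by (simp add: S_def)
    moreover have "\<exists>i\<in>F. c' i \<noteq> 0" using c(1) G by (auto simp: c'_def)
    ultimately show ?thesis using sum_c' by (intro exI[of _ c']) auto
  qed
qed

lemma eventually_mult_le_at_right_0:
  fixes a b :: real
  assumes "0 < b"
  shows "eventually (\<lambda>e. e * a \<le> b) (at_right 0)"
proof -
  have "((\<lambda>e. e * a) \<longlongrightarrow> 0 * a) (at_right 0)"
    by (intro tendsto_intros)
  then have "eventually (\<lambda>e. e * a < b) (at_right 0)"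
    using assms by (intro order_tendstoD(2)[of _ 0]) auto
  then show ?thesis by eventually_elim simp
qed

text \<open>By \<open>steps\<close>, the move cannot reverse the sign of
  \<open>x (t + 1) i - x t i\<close>, and equal neighbours stay equal. The absolute value is
  therefore linear along the move, and the \<open>sgn\<close> term is its exact change. So the new
  \<open>z\<close> is again tight, and a tight \<open>z\<close> over values in [0,1] meets all its
  constraints.\<close>

lemma lp_feasible_add_direction:
  assumes feas: "lp_feasible K (x, z)"
    and tight: "\<And>t i. t \<in> {1..<horizon K} \<Longrightarrow> i \<in> {1..objects K} \<Longrightarrow>
           z t i = 1 - \<bar>x (t + 1) i - x t i\<bar>"
    and bounds: "\<And>t i. t \<in> {1..horizon K} \<Longrightarrow> i \<in> {1..objects K} \<Longrightarrow>
           \<bar>d t i\<bar> \<le> x t i \<and> \<bar>d t i\<bar> \<le> 1 - x t i"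
    and steps: "\<And>t i. t \<in> {1..<horizon K} \<Longrightarrow> i \<in> {1..objects K} \<Longrightarrow>
           \<bar>d (t + 1) i - d t i\<bar> \<le> \<bar>x (t + 1) i - x t i\<bar>"
    and cap: "\<And>t. t \<in> {1..horizon K} \<Longrightarrow> (\<Sum>i\<in>{1..objects K}. weight K t i * d t i) = 0"
  shows "lp_feasible K (\<lambda>t i. x t i + d t i,
           \<lambda>t i. z t i - sgn (x (t + 1) i - x t i) * (d (t + 1) i - d t i))"
proof -
  have box: "0 \<le> x t i + d t i \<and> x t i + d t i \<le> 1"
    if "t \<in> {1..horizon K}" "i \<in> {1..objects K}" for t i
    using bounds[OF that] by linarith
  have z_eq: "z t i - sgn (x (t + 1) i - x t i) * (d (t + 1) i - d t i)
      = 1 - \<bar>(x (t + 1) i + d (t + 1) i) - (x t i + d t i)\<bar>"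
    if "t \<in> {1..<horizon K}" "i \<in> {1..objects K}" for t i
    using tight[OF that] steps[OF that] by (auto simp: sgn_if)
  have "(\<Sum>i\<in>{1..objects K}. weight K t i * (x t i + d t i)) \<le> capacity K t"
    if "t \<in> {1..horizon K}" for t
    using feas cap[OF that] that by (simp add: distrib_left sum.distrib)
  moreover have "0 \<le> 1 - \<bar>(x (t + 1) i + d (t + 1) i) - (x t i + d t i)\<bar>"
    if "t \<in> {1..<horizon K}" "i \<in> {1..objects K}" for t i
    using box[of t i] box[of "t + 1" i] that by fastforce
  ultimately show ?thesis
    using box z_eq by auto
qed

text \<open>A nonzero \<open>d\<close> could be followed a little way both forwards and backwards,
  making the point a midpoint. Here \<open>interior\<close> leaves room in the box, and
  \<open>const\<close> covers the transitions where \<open>steps\<close> of the previous lemma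
  allows no change at all.\<close>

lemma lp_basic_direction_zero:
  assumes basic: "lp_basic K (x, z)"
    and tight: "\<And>t i. t \<in> {1..<horizon K} \<Longrightarrow> i \<in> {1..objects K} \<Longrightarrow>
           z t i = 1 - \<bar>x (t + 1) i - x t i\<bar>"
    and interior: "\<And>t i. t \<in> {1..horizon K} \<Longrightarrow> i \<in> {1..objects K} \<Longrightarrow>
           d t i \<noteq> 0 \<Longrightarrow> 0 < x t i \<and> x t i < 1"
    and const: "\<And>t i. t \<in> {1..<horizon K} \<Longrightarrow> i \<in> {1..objects K} \<Longrightarrow>
           x (t + 1) i = x t i \<Longrightarrow> d (t + 1) i = d t i"
    and cap: "\<And>t. t \<in> {1..horizon K} \<Longrightarrow> (\<Sum>i\<in>{1..objects K}. weight K t i * d t i) = 0"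
    and "s \<in> {1..horizon K}" "j \<in> {1..objects K}"
  shows "d s j = 0"
proof (rule ccontr)
  assume "d s j \<noteq> 0"
  have feas: "lp_feasible K (x, z)" using basic by (simp add: lp_basic_def)
  \<comment> \<open>Each condition on the step length \<open>e\<close> holds for all small enough
    positive \<open>e\<close>. As there are finitely many, the filter \<open>at_right 0\<close>
    yields one \<open>e\<close> that meets them all.\<close>
  have "eventually (\<lambda>e. e * \<bar>d t i\<bar> \<le> x t i \<and> e * \<bar>d t i\<bar> \<le> 1 - x t i) (at_right 0)"
    if "t \<in> {1..horizon K}" "i \<in> {1..objects K}" for t i
  proof (cases "d t i = 0")
    case True
    then show ?thesis using feas that by auto
  next
    case False
    then show ?thesis using interior[OF that]
      by (intro eventually_conj eventually_mult_le_at_right_0) auto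
  qed
  then have ev_bounds: "eventually (\<lambda>e. \<forall>t\<in>{1..horizon K}. \<forall>i\<in>{1..objects K}.
      e * \<bar>d t i\<bar> \<le> x t i \<and> e * \<bar>d t i\<bar> \<le> 1 - x t i) (at_right 0)"
    by (intro eventually_ball_finite ballI) auto
  have "eventually (\<lambda>e. e * \<bar>d (t + 1) i - d t i\<bar> \<le> \<bar>x (t + 1) i - x t i\<bar>) (at_right 0)"
    if "t \<in> {1..<horizon K}" "i \<in> {1..objects K}" for t i
  proof (cases "x (t + 1) i = x t i")
    case True
    then show ?thesis using const[OF that] by simp
  next
    case False
    then show ?thesis by (intro eventually_mult_le_at_right_0) auto
  qed
  then have ev_steps: "eventually (\<lambda>e. \<forall>t\<in>{1..<horizon K}. \<forall>i\<in>{1..objects K}.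
      e * \<bar>d (t + 1) i - d t i\<bar> \<le> \<bar>x (t + 1) i - x t i\<bar>) (at_right 0)"
    by (intro eventually_ball_finite ballI) auto
  have "eventually (\<lambda>e. 0 < (e::real)) (at_right 0)"
    by (rule eventually_at_right_less)
  with ev_bounds ev_steps have "eventually (\<lambda>e.
      (\<forall>t\<in>{1..horizon K}. \<forall>i\<in>{1..objects K}.
        e * \<bar>d t i\<bar> \<le> x t i \<and> e * \<bar>d t i\<bar> \<le> 1 - x t i) \<and>
      (\<forall>t\<in>{1..<horizon K}. \<forall>i\<in>{1..objects K}.
        e * \<bar>d (t + 1) i - d t i\<bar> \<le> \<bar>x (t + 1) i - x t i\<bar>) \<and> 0 < e) (at_right 0)"
    by eventually_elim blast
  then obtain e where e: "0 < e"
      "\<And>t i. t \<in> {1..horizon K} \<Longrightarrow> i \<in> {1..objects K} \<Longrightarrow>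
         e * \<bar>d t i\<bar> \<le> x t i \<and> e * \<bar>d t i\<bar> \<le> 1 - x t i"
      "\<And>t i. t \<in> {1..<horizon K} \<Longrightarrow> i \<in> {1..objects K} \<Longrightarrow>
         e * \<bar>d (t + 1) i - d t i\<bar> \<le> \<bar>x (t + 1) i - x t i\<bar>"
    using eventually_happens'[OF trivial_limit_at_right_real] by blast
  \<comment> \<open>The sign is that of the unmoved \<open>x\<close>, so \<open>P r\<close> is
    affine in \<open>r\<close> in both components, and \<open>P e\<close> and \<open>P (- e)\<close>
    average exactly to \<open>(x, z)\<close>.\<close>
  define P where "P r = (\<lambda>t i. x t i + r * d t i,
      \<lambda>t i. z t i - sgn (x (t + 1) i - x t i) * (r * d (t + 1) i - r * d t i))" for r
  have P_feas: "lp_feasible K (P r)" if "\<bar>r\<bar> = e" for r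
    unfolding P_def
  proof (rule lp_feasible_add_direction[OF feas tight])
    show "(\<Sum>i\<in>{1..objects K}. weight K t i * (r * d t i)) = 0" if "t \<in> {1..horizon K}" for t
      using cap[OF that] by (simp add: mult.left_commute[of _ r] flip: sum_distrib_left)
  qed (use e that in \<open>auto simp: abs_mult simp flip: right_diff_distrib\<close>)
  have "\<not> lp_same K (P e) (P (- e))"
    using \<open>d s j \<noteq> 0\<close> e(1) assms(6,7) by (auto simp: P_def)
  moreover have "lp_same K (x, z) (lp_midpoint (P e) (P (- e)))"
    by (simp add: P_def field_simps)
  ultimately show False
    using basic P_feas[of e] P_feas[of "- e"] e(1) unfolding lp_basic_def
    by (metis abs_minus_cancel abs_of_pos)
qed

theorem theorem3:
  fixes K :: multistage_knapsack
    and x z :: "nat \<Rightarrow> nat \<Rightarrow> real"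
  assumes "valid_instance K"
    and "lp_feasible K (x, z)"
    and "\<And>t i. t \<in> {1..<horizon K} \<Longrightarrow> i \<in> {1..objects K} \<Longrightarrow>
           z t i = 1 - \<bar>x (t + 1) i - x t i\<bar>"
    and "lp_basic K (x, z)"
  shows "card {i \<in> {1..objects K}. fractional_object K (x, z) i} \<le> horizon K ^ 3"
proof -
  define F where "F = {i \<in> {1..objects K}. fractional_object K (x, z) i}"
  have F: "finite F" "F \<subseteq> {1..objects K}" by (auto simp: F_def)
  \<comment> \<open>Tightness makes \<open>z t i\<close> an integer whenever both neighbouring
    \<open>x\<close> values are, so a fractional object has a fractional \<open>x\<close>
    value.\<close>
  have "\<exists>t\<in>{1..horizon K}. x t i \<notin> \<int>" if "i \<in> F" for i
  proof (rule ccontr)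
    assume "\<not> (\<exists>t\<in>{1..horizon K}. x t i \<notin> \<int>)"
    then have int: "x t i \<in> \<int>" if "t \<in> {1..horizon K}" for t using that by blast
    have "z t i \<in> \<int>" if "t \<in> {1..<horizon K}" for t
    proof -
      have "x t i \<in> \<int>" "x (t + 1) i \<in> \<int>" using that by (auto intro!: int)
      then show ?thesis using assms(3)[OF that, of i] \<open>i \<in> F\<close> F(2) by auto
    qed
    with int \<open>i \<in> F\<close> show False by (auto simp: F_def)
  qed
  then obtain u where u: "\<And>i. i \<in> F \<Longrightarrow> u i \<in> {1..horizon K} \<and> x (u i) i \<notin> \<int>"
    by metis
  have frac: "0 < x (u i) i \<and> x (u i) i < 1" if "i \<in> F" for i
  proof -
    have "0 \<le> x (u i) i \<and> x (u i) i \<le> 1" using assms(2) u[OF that] that F(2) by auto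
    moreover have "x (u i) i \<noteq> 0" "x (u i) i \<noteq> 1" using u[OF that] by auto
    ultimately show ?thesis by linarith
  qed
  have "card F \<le> horizon K"
  proof (rule ccontr)
    assume "\<not> card F \<le> horizon K"
    then have "card {1..horizon K} < card F" by simp
    \<comment> \<open>The unknowns are the speeds \<open>c i\<close>, with one equation per time.
      Object \<open>i\<close> contributes its weight only at times when it has the chosen value and
      hence moves.\<close>
    then obtain c where c: "\<exists>i\<in>F. c i \<noteq> 0"
        "\<forall>t\<in>{1..horizon K}.
          (\<Sum>i\<in>F. (if x t i = x (u i) i then weight K t i else 0) * c i) = 0"
      using underdetermined_system_nontrivial_solution[of "{1..horizon K}" F
          "\<lambda>t i. if x t i = x (u i) i then weight K t i else 0"] F(1) by blast
    \<comment> \<open>Since \<open>d t i\<close> depends on \<open>t\<close> only through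
      \<open>x t i\<close>, equal neighbours move equally. It is nonzero only where
      \<open>x t i\<close> is the fractional value \<open>x (u i) i\<close>.\<close>
    define d where "d t i = (if i \<in> F \<and> x t i = x (u i) i then c i else 0)" for t i
    have cap: "(\<Sum>i\<in>{1..objects K}. weight K t i * d t i) = 0" if "t \<in> {1..horizon K}" for t
    proof -
      have "(\<Sum>i\<in>{1..objects K}. weight K t i * d t i) = (\<Sum>i\<in>F. weight K t i * d t i)"
        using F by (intro sum.mono_neutral_right) (auto simp: d_def)
      also have "\<dots> = (\<Sum>i\<in>F. (if x t i = x (u i) i then weight K t i else 0) * c i)"
        by (intro sum.cong) (auto simp: d_def)
      finally show ?thesis using c(2) that by simp
    qed
    have d_zero: "d t i = 0" if "t \<in> {1..horizon K}" "i \<in> {1..objects K}" for t i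
    proof (rule lp_basic_direction_zero[OF assms(4,3) _ _ cap that])
      show "0 < x t i \<and> x t i < 1" if "d t i \<noteq> 0" for t i
        using that frac[of i] by (auto simp: d_def split: if_splits)
    qed (auto simp: d_def)
    \<comment> \<open>At time \<open>u j\<close> object \<open>j\<close> has its chosen value by
      definition, so \<open>d (u j) j\<close> is \<open>c j\<close>.\<close>
    obtain j where "j \<in> F" "c j \<noteq> 0" using c(1) by blast
    then show False using d_zero[of "u j" j] u[of j] F(2) by (auto simp: d_def)
  qed
  also have "\<dots> \<le> horizon K ^ 3" by (cases "horizon K = 0") (auto intro: self_le_power)
  finally show ?thesis by (simp add: F_def)
qed

end
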